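(* Let $r \ge 2$ be an integer and let $F_r$ be the free group of rank $r$ with a fixed free generating set $S$. For a subgroup $H \le F_r$ let $\omega(H) = \lim_{n\to\infty} \bigl|\{h \in H : |h|_S \le n\}\bigr|^{1/n}$ be its growth rate. Then the set $$\{\omega(H) : H \text{ is a finitely generated subgroup of } F_r\}$$ is dense in the interval $[1, 2r-1]$.
   Context: $|\cdot|_S$ denotes word length in $F_r$ with respect to the free generating set $S$. For a subgroup $H\le F_r$, the growth function is $\gamma_H(n) = |\{h\in H : |h|_S\le n\}|$ and the growth rate is $\omega(H)=\lim_{n\to\infty}\gamma_H(n)^{1/n}$; this limit exists. Any subgroup $H\le F_r$ has $\omega(H)\in[1,2r-1]$. *)

theory Defs
  imports "HOL-Algebra.Generated_Groups" "HOL-Analysis.Analysis"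
begin

text \<open>
  Words over \<open>S \<union> S\<^sup>-\<^sup>1\<close> are lists of signed generators:
  \<open>(s, True)\<close> stands for \<open>s\<close> and \<open>(s, False)\<close> for its inverse.
\<close>

definition word_val :: "('a, 'b) monoid_scheme \<Rightarrow> ('a \<times> bool) list \<Rightarrow> 'a" where
  "word_val G w =
     foldr (\<lambda>(s, b) g. (if b then s else inv\<^bsub>G\<^esub> s) \<otimes>\<^bsub>G\<^esub> g) w \<one>\<^bsub>G\<^esub>"

definition words :: "'a set \<Rightarrow> ('a \<times> bool) list set" where
  "words S = lists (S \<times> UNIV)"

definition reduced :: "('a \<times> bool) list \<Rightarrow> bool" where
  "reduced w \<longleftrightarrow> successively (\<lambda>x y. \<not> (fst x = fst y \<and> snd x \<noteq> snd y)) w"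

definition free_generating_set :: "('a, 'b) monoid_scheme \<Rightarrow> 'a set \<Rightarrow> bool" where
  "free_generating_set G S \<longleftrightarrow>
     S \<subseteq> carrier G \<and> generate G S = carrier G \<and>
     (\<forall>w\<in>words S. reduced w \<and> w \<noteq> [] \<longrightarrow> word_val G w \<noteq> \<one>\<^bsub>G\<^esub>)"

definition word_length :: "('a, 'b) monoid_scheme \<Rightarrow> 'a set \<Rightarrow> 'a \<Rightarrow> nat" where
  "word_length G S g = (LEAST n. \<exists>w\<in>words S. word_val G w = g \<and> length w = n)"

definition growth_function :: "('a, 'b) monoid_scheme \<Rightarrow> 'a set \<Rightarrow> 'a set \<Rightarrow> nat \<Rightarrow> nat" where
  "growth_function G S H n = card {h \<in> H. word_length G S h \<le> n}"

definition growth_rate :: "('a, 'b) monoid_scheme \<Rightarrow> 'a set \<Rightarrow> 'a set \<Rightarrow> real" where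
  "growth_rate G S H = lim (\<lambda>n. root n (real (growth_function G S H n)))"

definition fg_subgroup :: "'a set \<Rightarrow> ('a, 'b) monoid_scheme \<Rightarrow> bool" where
  "fg_subgroup H G \<longleftrightarrow> subgroup H G \<and> (\<exists>T. finite T \<and> T \<subseteq> H \<and> generate G T = H)"

end

theory Submission
  imports Defs "HOL-Library.Multiset" "HOL-Combinatorics.Permutations"
begin

text \<open>
  A finitely generated subgroup of a free group is read off a finite graph whose edges are
  labelled by generators: its elements are the labels of the closed paths at a base vertex.
  If no two edges with the same label leave, or enter, the same vertex, then reduced paths have
  reduced labels. The growth function therefore counts the reduced closed paths by their length.

  The proof moves through a family of such graphs from rate \<open>2 * r - 1\<close> down to rates near 1
  in small steps. The start is a finite cover of the rose with \<open>r\<close> petals, of large girth \<open>g\<close>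
  (\<open>large_girth_schreier_graph_exists\<close>); as a subgroup of finite index it has rate \<open>2 * r - 1\<close>
  (\<open>rate_empty_ge\<close>). A step subdivides one edge with label \<open>s\<close> into two edges with label \<open>s\<close>.
  This keeps the labelling admissible, so every graph in the family again belongs to a finitely
  generated subgroup.

  A reduced path cannot return to the same edge within \<open>g\<close> letters, since it would contain a short
  closed path. Hence one subdivision stretches closed paths by a factor of at most about
  \<open>1 + 1 / g\<close>, and the new rate \<open>\<rho>'\<close> satisfies \<open>\<rho> ^ g \<le> \<rho>' ^ (g + 1)\<close>
  (\<open>rate_subdivide\<close>). This bound is uniform: earlier subdivisions only make
  paths longer. When all edges have been subdivided into \<open>k\<close> pieces, the rate is at most the
  \<open>k\<close>-th root of \<open>2 * r - 1\<close> (\<open>rate_le\<close>). So the rates of the family leave no large gap in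
  the interval (\<open>rate_approximates\<close>), and the gaps shrink as \<open>g\<close> grows.

  The growth rate is defined as a limit, whose existence has to be proved for these subgroups. It
  follows from Fekete's argument, since cutting a closed path in two and closing up both
  halves by paths of bounded length shows that the counts are submultiplicative up to constants
  (\<open>card_loops_almost_submultiplicative\<close>).
\<close>

section \<open>Growth rates of real sequences\<close>

text \<open>
  Both sides are powers of \<open>x n\<close>, with exponents \<open>1 / p n\<close> and \<open>1 / m n\<close>, so passing from
  one root to the other raises it to the power \<open>p n / m n \<rightarrow> t\<close>.
\<close>

lemma root_change_index:
  fixes x :: "nat \<Rightarrow> real" and p m :: "nat \<Rightarrow> nat"
  assumes "(\<lambda>n. root (p n) (x n)) \<longlonglongrightarrow> \<rho>" and "\<rho> > 0" and "\<And>n. x n \<ge> 1"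
    and "eventually (\<lambda>n. p n > 0 \<and> m n > 0) sequentially"
    and "(\<lambda>n. real (p n) / real (m n)) \<longlonglongrightarrow> t"
  shows "(\<lambda>n. root (m n) (x n)) \<longlonglongrightarrow> \<rho> powr t"
proof -
  have "(\<lambda>n. root (p n) (x n) powr (real (p n) / real (m n))) \<longlonglongrightarrow> \<rho> powr t"
    using assms by (intro tendsto_powr) auto
  moreover have "eventually (\<lambda>n. root (p n) (x n) powr (real (p n) / real (m n)) = root (m n) (x n)) sequentially"
    using assms(4)
  proof eventually_elim
    case (elim n)
    have x: "x n > 0" using assms(3)[of n] by linarith
    show ?case using elim x by (simp add: root_powr_inverse powr_powr)
  qed
  ultimately show ?thesis by (rule Lim_transform_eventually)
qed

text \<open>
  Rescaling the argument of a counting function by \<open>k\<close> raises its growth rate to the power \<open>k\<close>,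
  while a bounded shift changes nothing. This turns inequalities between counting functions
  into inequalities between growth rates.
\<close>

lemma root_subsequence_affine:
  fixes a :: "nat \<Rightarrow> real"
  assumes lim: "(\<lambda>n. root n (a n)) \<longlonglongrightarrow> \<rho>" and pos: "\<rho> > 0" and ge1: "\<And>n. a n \<ge> 1" and "k > 0"
  shows "(\<lambda>n. root n (a (k * n + j))) \<longlonglongrightarrow> \<rho> ^ k"
proof -
  have mono: "strict_mono (\<lambda>n. k * n + j)" using \<open>k > 0\<close> by (auto simp: strict_mono_def)
  have "(\<lambda>n. root (k * n + j) (a (k * n + j))) \<longlonglongrightarrow> \<rho>"
    using LIMSEQ_subseq_LIMSEQ[OF lim mono] by (simp add: o_def)
  moreover have "(\<lambda>n. real (k * n + j) / real n) \<longlonglongrightarrow> real k"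
  proof -
    have "(\<lambda>n. real k + real j / real n) \<longlonglongrightarrow> real k + 0"
      by (intro tendsto_intros lim_const_over_n)
    moreover have "eventually (\<lambda>n. real k + real j / real n = real (k * n + j) / real n) sequentially"
      using eventually_gt_at_top[of 0] by eventually_elim (simp add: field_simps)
    ultimately show ?thesis using Lim_transform_eventually by fastforce
  qed
  moreover have "eventually (\<lambda>n. k * n + j > 0 \<and> n > 0) sequentially"
    using eventually_gt_at_top[of 0] by eventually_elim (use \<open>k > 0\<close> in auto)
  ultimately have "(\<lambda>n. root n (a (k * n + j))) \<longlonglongrightarrow> \<rho> powr real k"
    using root_change_index[where p = "\<lambda>n. k * n + j" and m = "\<lambda>n. n" and x = "\<lambda>n. a (k * n + j)"] pos ge1
    by blast
  then show ?thesis using pos by (simp add: powr_realpow)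
qed

text \<open>
  Fekete's argument in multiplicative form: the limit is the infimum of the roots. If the
  \<open>k\<close>-th root is close to the infimum, writing \<open>n = k * d + i\<close> with \<open>i < k\<close> bounds \<open>h n\<close> by
  \<open>h k ^ d\<close> times a constant, whose \<open>n\<close>-th root tends to 1.
\<close>

lemma submultiplicative_root_convergent:
  fixes h :: "nat \<Rightarrow> real"
  assumes ge1: "\<And>n. h n \<ge> 1" and sub: "\<And>m n. h (m + n) \<le> h m * h n"
  obtains L where "L \<ge> 1" and "(\<lambda>n. root n (h n)) \<longlonglongrightarrow> L"
proof -
  define A where "A = (\<lambda>n. root n (h n)) ` {0<..}"
  have A1: "a \<ge> 1" if "a \<in> A" for a using that ge1 by (auto simp: A_def)
  have bdd: "bdd_below A" using A1 by (meson bdd_belowI)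
  have ne: "A \<noteq> {}" by (auto simp: A_def)
  have L1: "Inf A \<ge> 1" using ne A1 by (meson cInf_greatest)
  have low: "Inf A \<le> root n (h n)" if "n > 0" for n
    using that bdd by (intro cInf_lower) (auto simp: A_def)
  have pow: "h (k * d) \<le> h k ^ d" if "d > 0" for k d
    using that
  proof (induction d rule: nat_induct_non_zero)
    case (Suc d)
    have "h (k * Suc d) \<le> h k * h (k * d)" using sub[of k "k * d"] by simp
    also have "\<dots> \<le> h k * h k ^ d" using Suc ge1[of k] by (intro mult_left_mono) auto
    finally show ?case by simp
  qed auto
  have "(\<lambda>n. root n (h n)) \<longlonglongrightarrow> Inf A"
  proof (rule order_tendstoI)
    fix b assume "b < Inf A"
    show "eventually (\<lambda>n. b < root n (h n)) sequentially"
      using eventually_gt_at_top[of 0] by eventually_elim (rule less_le_trans[OF \<open>b < Inf A\<close> low])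
  next
    fix b assume "Inf A < b"
    then obtain k where k: "k > 0" "root k (h k) < b"
      using ne bdd by (auto simp: A_def cInf_less_iff)
    define C where "C = Max (h ` {..<k})"
    have C: "h i \<le> C" if "i < k" for i using that by (auto simp: C_def)
    have C1: "C \<ge> 1" using C[of 0] ge1[of 0] k by linarith
    have rk1: "root k (h k) \<ge> 1" using ge1 k by auto
    have up: "root n (h n) \<le> root n C * root k (h k)" if "n \<ge> k" for n
    proof -
      have n: "n > 0" using that k by simp
      define d where "d = n div k"
      have d: "d > 0" using that k by (simp add: d_def div_greater_zero_iff)
      have nd: "n = k * d + n mod k" by (simp add: d_def)
      have "h n \<le> h (k * d) * h (n mod k)" using sub[of "k * d" "n mod k"] nd by simp
      also have "\<dots> \<le> h k ^ d * C"
        using pow[OF d, of k] C[of "n mod k"] k ge1[of "n mod k"] ge1[of k] by (intro mult_mono) auto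
      also have "h k ^ d = root k (h k) ^ (k * d)"
        using k ge1[of k] by (simp add: power_mult)
      also have "\<dots> \<le> root k (h k) ^ n"
        using rk1 nd by (intro power_increasing) auto
      finally have "h n \<le> root k (h k) ^ n * C" using C1 by (simp add: mult_right_mono)
      then have "root n (h n) \<le> root n (root k (h k) ^ n * C)" using n by simp
      also have "\<dots> = root k (h k) * root n C" using n rk1 by (simp add: real_root_mult real_root_power_cancel)
      finally show ?thesis by (simp add: mult.commute)
    qed
    have "(\<lambda>n. root n C * root k (h k)) \<longlonglongrightarrow> 1 * root k (h k)"
      using C1 by (intro tendsto_intros LIMSEQ_root_const) auto
    then have "eventually (\<lambda>n. root n C * root k (h k) < b) sequentially"
      using k by (auto dest: order_tendstoD)
    then show "eventually (\<lambda>n. root n (h n) < b) sequentially"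
      using eventually_ge_at_top[of k] by eventually_elim (rule le_less_trans[OF up])
  qed
  then show ?thesis using that L1 by blast
qed

text \<open>
  Counts of closed paths are submultiplicative only up to a factor and a shift, because a path
  that is cut in two has to be closed up again. The function \<open>\<lambda>n. D * g (n + 2 * c)\<close> absorbs
  both defects.
\<close>

lemma almost_submultiplicative_root_convergent:
  fixes g :: "nat \<Rightarrow> real"
  assumes ge1: "\<And>n. g n \<ge> 1" and D: "D \<ge> 1"
    and sub: "\<And>m n. g (m + n) \<le> D * g (m + c) * g (n + c)"
  obtains \<rho> where "\<rho> \<ge> 1" and "(\<lambda>n. root n (g n)) \<longlonglongrightarrow> \<rho>"
proof -
  have "D * g (m + n + 2 * c) \<le> (D * g (m + 2 * c)) * (D * g (n + 2 * c))" for m n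
  proof -
    have "g (m + n + 2 * c) \<le> D * g (m + 2 * c) * g (n + 2 * c)"
    proof -
      have "m + c + (n + c) = m + n + 2 * c" "m + c + c = m + 2 * c" "n + c + c = n + 2 * c" by auto
      then show ?thesis using sub[of "m + c" "n + c"] by (simp only:)
    qed
    then have "D * g (m + n + 2 * c) \<le> D * (D * g (m + 2 * c) * g (n + 2 * c))"
      using D by (intro mult_left_mono) auto
    then show ?thesis by (simp add: algebra_simps)
  qed
  moreover have "D * g (n + 2 * c) \<ge> 1" for n
    using D ge1[of "n + 2 * c"] mult_mono[of 1 D 1 "g (n + 2 * c)"] by simp
  ultimately obtain L where L: "L \<ge> 1" "(\<lambda>n. root n (D * g (n + 2 * c))) \<longlonglongrightarrow> L"
    using submultiplicative_root_convergent[of "\<lambda>n. D * g (n + 2 * c)"] by blast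
  have rD: "(\<lambda>n. root n D) \<longlonglongrightarrow> 1" using D by (intro LIMSEQ_root_const) auto
  have "(\<lambda>n. root n (D * g (n + 2 * c)) / root n D) \<longlonglongrightarrow> L / 1"
    by (intro tendsto_divide L rD) auto
  moreover have "eventually (\<lambda>n. root n (D * g (n + 2 * c)) / root n D = root n (g (n + 2 * c))) sequentially"
    using eventually_gt_at_top[of 0] by eventually_elim (use D in \<open>simp add: real_root_mult\<close>)
  ultimately have 1: "(\<lambda>n. root n (g (n + 2 * c))) \<longlonglongrightarrow> L"
    using Lim_transform_eventually by fastforce
  have 2: "(\<lambda>n. real n / real (n + 2 * c)) \<longlonglongrightarrow> 1"
  proof -
    have "(\<lambda>n. inverse (1 + real (2 * c) / real n)) \<longlonglongrightarrow> inverse (1 + 0)"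
      by (intro tendsto_intros lim_const_over_n) auto
    moreover have "eventually (\<lambda>n. inverse (1 + real (2 * c) / real n) = real n / real (n + 2 * c)) sequentially"
      using eventually_gt_at_top[of 0] by eventually_elim (simp add: field_simps)
    ultimately show ?thesis using Lim_transform_eventually by fastforce
  qed
  have 3: "eventually (\<lambda>n. n > 0 \<and> n + 2 * c > 0) sequentially"
    using eventually_gt_at_top[of 0] by eventually_elim auto
  have "L > 0" using L by simp
  from root_change_index[OF 1 this ge1 3 2]
  have "(\<lambda>n. root (n + 2 * c) (g (n + 2 * c))) \<longlonglongrightarrow> L powr 1" .
  then have "(\<lambda>n. root n (g n)) \<longlonglongrightarrow> L"
    using LIMSEQ_offset[of "\<lambda>n. root n (g n)" "2 * c"] L by simp
  then show ?thesis using that L by blast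
qed

section \<open>Reduced words\<close>

definition inv_letter :: "'a \<times> bool \<Rightarrow> 'a \<times> bool" where
  "inv_letter x = (fst x, \<not> snd x)"

lemma inv_letter_invol [simp]: "inv_letter (inv_letter x) = x"
  by (simp add: inv_letter_def)

lemma inv_letter_neq [simp]: "inv_letter x \<noteq> x" "x \<noteq> inv_letter x"
  by (cases x, simp add: inv_letter_def)+

lemma inv_letter_eq_iff: "inv_letter x = y \<longleftrightarrow> x = inv_letter y"
  by auto

lemma fst_inv_letter [simp]: "fst (inv_letter x) = fst x"
  by (simp add: inv_letter_def)

definition inv_word :: "('a \<times> bool) list \<Rightarrow> ('a \<times> bool) list" where
  "inv_word w = rev (map inv_letter w)"

lemma inv_word_simps [simp]:
  "inv_word [] = []" "inv_word (x # w) = inv_word w @ [inv_letter x]"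
  "inv_word (v @ w) = inv_word w @ inv_word v" "inv_word (inv_word w) = w"
  "length (inv_word w) = length w" "inv_word w = [] \<longleftrightarrow> w = []"
  by (auto simp: inv_word_def rev_map o_def)

lemma hd_inv_word: "w \<noteq> [] \<Longrightarrow> hd (inv_word w) = inv_letter (last w)"
  by (simp add: inv_word_def hd_rev last_map)

lemma last_inv_word: "w \<noteq> [] \<Longrightarrow> last (inv_word w) = inv_letter (hd w)"
  by (simp add: inv_word_def last_rev hd_map)

lemma reduced_iff: "reduced w \<longleftrightarrow> successively (\<lambda>x y. y \<noteq> inv_letter x) w"
proof -
  have "(\<lambda>x y :: 'a \<times> bool. \<not> (fst x = fst y \<and> snd x \<noteq> snd y)) = (\<lambda>x y. y \<noteq> inv_letter x)"
    by (auto simp: inv_letter_def fun_eq_iff prod_eq_iff)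
  then show ?thesis by (simp only: reduced_def)
qed

lemma reduced_Nil [simp]: "reduced []"
  by (simp add: reduced_def)

lemma reduced_Cons: "reduced (x # w) \<longleftrightarrow> (w = [] \<or> hd w \<noteq> inv_letter x) \<and> reduced w"
  by (auto simp: reduced_iff successively_Cons)

lemma reduced_append:
  "reduced (v @ w) \<longleftrightarrow> reduced v \<and> reduced w \<and> (v = [] \<or> w = [] \<or> hd w \<noteq> inv_letter (last v))"
  by (auto simp: reduced_iff successively_append_iff)

lemma reduced_inv_word [simp]: "reduced (inv_word w) \<longleftrightarrow> reduced w"
proof (induction w)
  case (Cons x w)
  then show ?case
    by (cases "w = []") (auto simp: reduced_Cons reduced_append last_inv_word inv_letter_eq_iff)
qed simp

lemma reduced_replicate [simp]: "reduced (replicate n x)"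
  by (induction n) (auto simp: reduced_Cons hd_replicate)

lemma words_iff: "w \<in> words S \<longleftrightarrow> (\<forall>x\<in>set w. fst x \<in> S)"
  by (auto simp: words_def lists_eq_set)

lemma words_simps [simp]:
  "[] \<in> words S" "x # w \<in> words S \<longleftrightarrow> fst x \<in> S \<and> w \<in> words S"
  "v @ w \<in> words S \<longleftrightarrow> v \<in> words S \<and> w \<in> words S" "inv_word w \<in> words S \<longleftrightarrow> w \<in> words S"
  by (auto simp: words_iff inv_word_def)

text \<open>
  Free reduction, performed from the right: each letter is either put in front of the reduced
  tail or cancels its first letter.
\<close>

definition reduce_Cons :: "'a \<times> bool \<Rightarrow> ('a \<times> bool) list \<Rightarrow> ('a \<times> bool) list" where
  "reduce_Cons x w = (if w \<noteq> [] \<and> hd w = inv_letter x then tl w else x # w)"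

definition reduce :: "('a \<times> bool) list \<Rightarrow> ('a \<times> bool) list" where
  "reduce w = foldr reduce_Cons w []"

lemma reduce_simps: "reduce [] = []" "reduce (x # w) = reduce_Cons x (reduce w)"
  by (simp_all add: reduce_def)

lemma reduce_Cons_cases:
  obtains w' where "w = inv_letter x # w'" "reduce_Cons x w = w'"
  | "reduce_Cons x w = x # w" "w = [] \<or> hd w \<noteq> inv_letter x"
  by (cases w) (auto simp: reduce_Cons_def split: if_splits)

lemma reduced_reduce: "reduced (reduce w)"
proof (induction w)
  case (Cons x w)
  show ?case
    by (rule reduce_Cons_cases[of "reduce w" x])
      (use Cons in \<open>auto simp: reduce_simps reduced_Cons\<close>)
qed (simp add: reduce_simps)

lemma length_reduce: "length (reduce w) \<le> length w"
proof (induction w)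
  case (Cons x w)
  show ?case
    by (rule reduce_Cons_cases[of "reduce w" x]) (use Cons in \<open>auto simp: reduce_simps\<close>)
qed (simp add: reduce_simps)

lemma reduce_in_words: "w \<in> words S \<Longrightarrow> reduce w \<in> words S"
proof (induction w)
  case (Cons x w)
  show ?case
    by (rule reduce_Cons_cases[of "reduce w" x]) (use Cons in \<open>auto simp: reduce_simps\<close>)
qed (simp add: reduce_simps)

definition reduced_words :: "'a set \<Rightarrow> nat \<Rightarrow> ('a \<times> bool) list set" where
  "reduced_words S n = {w \<in> words S. reduced w \<and> length w = n}"

lemma finite_words_le: "finite S \<Longrightarrow> finite {w \<in> words S. length w \<le> n}"
  unfolding words_def in_lists_conv_set subset_eq[symmetric]
  using finite_lists_length_le[of "S \<times> (UNIV :: bool set)" n] by (simp add: in_lists_conv_set subset_eq)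

lemma finite_reduced_words: "finite S \<Longrightarrow> finite (reduced_words S n)"
  by (rule finite_subset[OF _ finite_words_le[of S n]]) (auto simp: reduced_words_def)

text \<open>
  A nonempty reduced word extends to the left by every letter except the inverse of its head.
\<close>

lemma card_reduced_words:
  assumes "finite S"
  shows "card (reduced_words S (Suc n)) = 2 * card S * (2 * card S - 1) ^ n"
proof (induction n)
  case 0
  have "reduced_words S (Suc 0) = (\<lambda>x. [x]) ` (S \<times> UNIV)"
    by (auto simp: reduced_words_def length_Suc_conv reduced_Cons image_iff)
  then show ?case by (simp add: card_image inj_on_def card_cartesian_product)
next
  case (Suc n)
  have "bij_betw (\<lambda>(w, x). x # w)
      (SIGMA w : reduced_words S (Suc n). (S \<times> UNIV) - {inv_letter (hd w)}) (reduced_words S (Suc (Suc n)))"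
    by (rule bij_betwI[where g = "\<lambda>w. (tl w, hd w)"])
      (auto simp: reduced_words_def length_Suc_conv reduced_Cons)
  then have "card (reduced_words S (Suc (Suc n))) =
      (\<Sum>w\<in>reduced_words S (Suc n). card ((S \<times> (UNIV :: bool set)) - {inv_letter (hd w)}))"
    using assms by (simp add: bij_betw_same_card[symmetric] finite_reduced_words)
  also have "\<dots> = (\<Sum>w\<in>reduced_words S (Suc n). 2 * card S - 1)"
  proof (rule sum.cong)
    fix w assume "w \<in> reduced_words S (Suc n)"
    then have "inv_letter (hd w) \<in> S \<times> UNIV"
      by (cases w) (auto simp: reduced_words_def inv_letter_def)
    then show "card ((S \<times> (UNIV :: bool set)) - {inv_letter (hd w)}) = 2 * card S - 1"
      using assms by (simp add: card_cartesian_product)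
  qed simp
  finally show ?case using Suc by simp
qed

lemma card_reduced_words_ge:
  assumes "finite S" "card S \<ge> 1"
  shows "(2 * card S - 1) ^ n \<le> card (reduced_words S n)"
proof (cases n)
  case 0
  have "reduced_words S 0 = {[]}" by (auto simp: reduced_words_def)
  with 0 show ?thesis by simp
next
  case (Suc m)
  then show ?thesis using card_reduced_words[OF assms(1), of m] by simp
qed

lemma card_reduced_words_le:
  assumes "finite S" "card S \<ge> 2"
  shows "card {w \<in> words S. reduced w \<and> length w \<le> n} \<le> 3 * (2 * card S - 1) ^ n"
proof (induction n)
  case 0
  have "{w \<in> words S. reduced w \<and> length w \<le> 0} = {[]}" by auto
  then show ?case by simp
next
  case (Suc n)
  define q where "q = 2 * card S - 1"
  have q: "q \<ge> 3" "2 * card S \<le> 2 * q" using assms by (auto simp: q_def)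
  have "{w \<in> words S. reduced w \<and> length w \<le> Suc n} =
      {w \<in> words S. reduced w \<and> length w \<le> n} \<union> reduced_words S (Suc n)"
    by (auto simp: reduced_words_def)
  then have "card {w \<in> words S. reduced w \<and> length w \<le> Suc n} \<le>
      card {w \<in> words S. reduced w \<and> length w \<le> n} + card (reduced_words S (Suc n))"
    by (simp add: card_Un_le)
  also have "\<dots> \<le> 3 * q ^ n + 2 * q * q ^ n"
    using Suc card_reduced_words[OF assms(1), of n] q by (intro add_mono) (auto simp: q_def)
  also have "\<dots> \<le> q * q ^ n + 2 * q * q ^ n" using q by (intro add_mono mult_right_mono) auto
  finally show ?case unfolding q_def[symmetric] power_Suc by simp
qed

section \<open>Word length in free groups\<close>

context group
begin

definition letter_val :: "'a \<times> bool \<Rightarrow> 'a" where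
  "letter_val x = (if snd x then fst x else inv (fst x))"

lemma word_val_Nil [simp]: "word_val G [] = \<one>"
  by (simp add: word_val_def)

lemma word_val_Cons: "word_val G (x # w) = letter_val x \<otimes> word_val G w"
  by (cases x) (simp add: word_val_def letter_val_def)

lemma letter_val_closed [simp]: "S \<subseteq> carrier G \<Longrightarrow> fst x \<in> S \<Longrightarrow> letter_val x \<in> carrier G"
  by (auto simp: letter_val_def)

lemma letter_val_inv: "S \<subseteq> carrier G \<Longrightarrow> fst x \<in> S \<Longrightarrow> letter_val (inv_letter x) = inv (letter_val x)"
  by (auto simp: letter_val_def inv_letter_def)

context
  fixes S assumes S: "S \<subseteq> carrier G"
begin

lemma word_val_closed [simp]: "w \<in> words S \<Longrightarrow> word_val G w \<in> carrier G"
  using S by (induction w) (auto simp: word_val_Cons)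

lemma word_val_append:
  "v \<in> words S \<Longrightarrow> w \<in> words S \<Longrightarrow> word_val G (v @ w) = word_val G v \<otimes> word_val G w"
  using S by (induction v) (auto simp: word_val_Cons m_assoc)

lemma word_val_inv_word: "w \<in> words S \<Longrightarrow> word_val G (inv_word w) = inv (word_val G w)"
proof (induction w)
  case (Cons x w)
  then show ?case using S letter_val_inv[OF S, of x]
    by (simp add: word_val_append word_val_Cons inv_mult_group)
qed simp

lemma word_val_reduce_Cons:
  assumes "fst x \<in> S" "w \<in> words S"
  shows "word_val G (reduce_Cons x w) = letter_val x \<otimes> word_val G w"
proof (rule reduce_Cons_cases[of w x])
  fix w' assume w: "w = inv_letter x # w'" "reduce_Cons x w = w'"
  then have "w' \<in> words S" using assms by simp
  then show ?thesis using w assms S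
    by (simp add: word_val_Cons letter_val_inv[OF S] m_assoc[symmetric] letter_val_closed[OF S])
qed (simp add: word_val_Cons)

lemma word_val_reduce: "w \<in> words S \<Longrightarrow> word_val G (reduce w) = word_val G w"
  by (induction w) (auto simp: reduce_simps word_val_reduce_Cons reduce_in_words word_val_Cons)

text \<open>
  Two reduced words with different heads can be joined, inverting one of them, into a
  nonempty reduced word; if their values agreed, that word would be trivial in the group.
  Equal heads are cancelled.
\<close>

lemma reduced_word_unique:
  assumes free: "\<forall>w\<in>words S. reduced w \<and> w \<noteq> [] \<longrightarrow> word_val G w \<noteq> \<one>"
  shows "v \<in> words S \<Longrightarrow> w \<in> words S \<Longrightarrow> reduced v \<Longrightarrow> reduced w \<Longrightarrow>
    word_val G v = word_val G w \<Longrightarrow> v = w"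
proof (induction v arbitrary: w)
  case Nil
  then show ?case using free by fastforce
next
  case (Cons x v)
  show ?case
  proof (cases w)
    case Nil
    then show ?thesis using Cons.prems free by fastforce
  next
    case w: (Cons y w')
    show ?thesis
    proof (cases "x = y")
      case True
      have "word_val G v = word_val G w'"
        using Cons.prems S True unfolding w
        by (simp add: word_val_Cons letter_val_closed[OF S])
      then show ?thesis using Cons True w by (simp add: reduced_Cons)
    next
      case False
      have "reduced (inv_word w @ x # v)"
        using Cons.prems False unfolding w
        by (auto simp: reduced_append reduced_Cons inv_letter_eq_iff last_inv_word)
      moreover have "word_val G (inv_word w @ x # v) = \<one>"
        using Cons.prems by (subst word_val_append) (auto simp: word_val_inv_word)
      moreover have "inv_word w @ x # v \<in> words S" using Cons.prems by simp
      ultimately show ?thesis using free by blast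
    qed
  qed
qed

text \<open>
  Any competitor reduces, without growing, to a reduced word of the same value, which is
  then the given word.
\<close>

lemma word_length_reduced:
  assumes free: "\<forall>w\<in>words S. reduced w \<and> w \<noteq> [] \<longrightarrow> word_val G w \<noteq> \<one>"
    and "w \<in> words S" "reduced w"
  shows "word_length G S (word_val G w) = length w"
  unfolding word_length_def
proof (rule Least_equality)
  show "\<exists>u\<in>words S. word_val G u = word_val G w \<and> length u = length w" using assms by blast
next
  fix n assume "\<exists>u\<in>words S. word_val G u = word_val G w \<and> length u = n"
  then obtain u where u: "u \<in> words S" "word_val G u = word_val G w" "length u = n" by blast
  then have "reduce u = w"
    using assms by (intro reduced_word_unique[OF free])
      (auto simp: reduce_in_words reduced_reduce word_val_reduce)
  then show "length w \<le> n" using length_reduce[of u] u by auto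
qed

end

end

section \<open>Closed paths in labelled graphs with subdivided edges\<close>

text \<open>
  A finite graph whose edges are labelled by \<open>S\<close> and in which each letter acts as a
  permutation of the vertices: a finite, possibly disconnected, cover of the rose with
  \<open>card S\<close> petals. The laws of \<open>act\<close> hold for all letters and on the whole vertex type, so
  that only membership in \<open>V\<close> has to be tracked.
\<close>

locale schreier_graph =
  fixes S :: "'a set" and act :: "'a \<times> bool \<Rightarrow> 'v \<Rightarrow> 'v" and V :: "'v set" and v\<^sub>0 :: 'v
  assumes finite_S: "finite S" and card_S: "card S \<ge> 2"
    and finite_V: "finite V" and base: "v\<^sub>0 \<in> V"
    and act_closed: "v \<in> V \<Longrightarrow> act x v \<in> V"
    and act_inv: "act (inv_letter x) (act x v) = v"
begin

abbreviation endpoint :: "'v \<Rightarrow> ('a \<times> bool) list \<Rightarrow> 'v" where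
  "endpoint v w \<equiv> fold act w v"

lemma endpoint_closed: "v \<in> V \<Longrightarrow> endpoint v w \<in> V"
  by (induction w arbitrary: v) (auto simp: act_closed)

lemma act_inv': "act x (act (inv_letter x) v) = v"
  using act_inv[of "inv_letter x" v] by simp

lemma act_eq_iff: "act x u = act x v \<longleftrightarrow> u = v"
  by (metis act_inv)

lemma endpoint_inv_word: "endpoint (endpoint v w) (inv_word w) = v"
  by (induction w arbitrary: v) (auto simp: act_inv)

text \<open>
  An unoriented edge is named by its generator and its initial vertex with respect to the
  orientation of that generator, so that a letter and its inverse traverse the same edge
  (\<open>edge_inv\<close>).
\<close>

definition edge :: "'v \<Rightarrow> 'a \<times> bool \<Rightarrow> 'v \<times> 'a" where
  "edge v x = (if snd x then v else act x v, fst x)"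

lemma edge_inv: "edge (act x v) (inv_letter x) = edge v x"
  using act_inv[of x v] by (cases x) (auto simp: edge_def inv_letter_def)

lemma edge_eqD:
  assumes "edge u x = edge v y"
  shows "(y = x \<and> u = v) \<or> (y = inv_letter x \<and> u = act y v)"
proof -
  have "fst x = fst y" using assms by (simp add: edge_def)
  then consider "y = x" | "y = inv_letter x"
    by (cases x; cases y) (auto simp: inv_letter_def)
  then show ?thesis
  proof cases
    case 1
    then show ?thesis using assms act_eq_iff by (auto simp: edge_def split: if_splits)
  next
    case 2
    then have "edge (act x u) y = edge v y" using assms edge_inv[of x u] by simp
    then have "act x u = v" using act_eq_iff by (auto simp: edge_def split: if_splits)
    then show ?thesis using 2 by (auto simp: act_inv)
  qed
qed

fun trail :: "'v \<Rightarrow> ('a \<times> bool) list \<Rightarrow> ('v \<times> 'a) list" where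
  "trail v [] = []"
| "trail v (x # w) = edge v x # trail (act x v) w"

lemma length_trail [simp]: "length (trail v w) = length w"
  by (induction w arbitrary: v) auto

lemma trail_append: "trail v (w @ w') = trail v w @ trail (endpoint v w) w'"
  by (induction w arbitrary: v) auto

lemma set_trail:
  "e \<in> set (trail v w) \<longleftrightarrow> (\<exists>w1 y w2. w = w1 @ y # w2 \<and> e = edge (endpoint v w1) y)"
proof (induction w arbitrary: v)
  case step: (Cons x w)
  show ?case
  proof
    assume "e \<in> set (trail v (x # w))"
    then consider "e = edge v x" | "e \<in> set (trail (act x v) w)" by auto
    then show "\<exists>w1 y w2. x # w = w1 @ y # w2 \<and> e = edge (endpoint v w1) y"
    proof cases
      case 1
      then show ?thesis by (intro exI[of _ "[]"]) auto
    next
      case 2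
      then obtain w1 y w2 where "w = w1 @ y # w2" "e = edge (endpoint (act x v) w1) y"
        using step.IH by auto
      then show ?thesis by (intro exI[of _ "x # w1"]) auto
    qed
  next
    assume "\<exists>w1 y w2. x # w = w1 @ y # w2 \<and> e = edge (endpoint v w1) y"
    then obtain w1 y w2 where *: "x # w = w1 @ y # w2" "e = edge (endpoint v w1) y" by blast
    show "e \<in> set (trail v (x # w))"
    proof (cases w1)
      case Nil
      then show ?thesis using * by simp
    next
      case (Cons z w1')
      then have "w = w1' @ y # w2 \<and> e = edge (endpoint (act x v) w1') y" using * by simp
      then have "e \<in> set (trail (act x v) w)" using step.IH by blast
      then show ?thesis by simp
    qed
  qed
qed simp

text \<open>
  A multiset of edges prescribes how often each edge is subdivided; an edge that is
  subdivided \<open>k\<close> times has length \<open>k + 1\<close>. Multisets make a single further subdivision an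
  induction step.
\<close>

definition edge_length :: "('v \<times> 'a) multiset \<Rightarrow> ('v \<times> 'a) \<Rightarrow> nat" where
  "edge_length M e = Suc (count M e)"

definition weight :: "('v \<times> 'a) multiset \<Rightarrow> 'v \<Rightarrow> ('a \<times> bool) list \<Rightarrow> nat" where
  "weight M v w = (\<Sum>e\<leftarrow>trail v w. edge_length M e)"

lemma weight_simps [simp]:
  "weight M v [] = 0" "weight M v (x # w) = edge_length M (edge v x) + weight M (act x v) w"
  "weight M v (w @ w') = weight M v w + weight M (endpoint v w) w'"
  by (auto simp: weight_def trail_append)

lemma length_le_weight: "length w \<le> weight M v w"
  by (induction w arbitrary: v) (auto simp: edge_length_def intro: le_SucI trans_le_add2)

lemma weight_le: "weight M v w \<le> Suc (size M) * length w"
proof (induction w arbitrary: v)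
  case (Cons x w)
  have "edge_length M (edge v x) \<le> Suc (size M)" by (simp add: edge_length_def count_le_size)
  then show ?case using Cons[of "act x v"] by simp
qed simp

lemma weight_ge:
  assumes "\<And>e. e \<in> V \<times> S \<Longrightarrow> k \<le> edge_length M e" "v \<in> V" "w \<in> words S"
  shows "k * length w \<le> weight M v w"
  using assms(2,3)
proof (induction w arbitrary: v)
  case (Cons x w)
  have "edge v x \<in> V \<times> S" using Cons.prems by (auto simp: edge_def act_closed)
  then show ?case using assms(1) Cons.IH[of "act x v"] Cons.prems
    by (simp add: act_closed add_mono)
qed simp

lemma weight_empty: "weight {#} v w = length w"
  by (induction w arbitrary: v) (auto simp: edge_length_def)

lemma weight_add_mset: "weight (add_mset e M) v w = weight M v w + count_list (trail v w) e"
  by (induction w arbitrary: v) (auto simp: edge_length_def)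

definition loops :: "('v \<times> 'a) multiset \<Rightarrow> nat \<Rightarrow> ('a \<times> bool) list set" where
  "loops M n = {w \<in> words S. reduced w \<and> endpoint v\<^sub>0 w = v\<^sub>0 \<and> weight M v\<^sub>0 w \<le> n}"

lemma loops_subset: "loops M n \<subseteq> {w \<in> words S. reduced w \<and> length w \<le> n}"
  using length_le_weight by (auto simp: loops_def intro: order_trans)

lemma finite_loops: "finite (loops M n)"
  by (rule finite_subset[OF _ finite_words_le[OF finite_S, of n]]) (use loops_subset in auto)

lemma Nil_in_loops: "[] \<in> loops M n"
  by (simp add: loops_def)

lemma card_loops_ge_1: "1 \<le> card (loops M n)"
  using Nil_in_loops finite_loops by (metis One_nat_def Suc_leI card_gt_0_iff empty_iff)

lemma letter_power_returns:
  assumes "u \<in> V"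
  obtains n where "n > 0" "endpoint u (replicate n x) = u"
proof -
  have "(act x ^^ n) u \<in> V" for n
    using endpoint_closed[OF assms, of "replicate n x"] by (simp add: fold_replicate)
  then have "finite {y. \<exists>n. y = (act x ^^ n) u}"
    by (intro finite_subset[OF _ finite_V]) auto
  moreover have "inj (act x)" by (auto simp: inj_def act_eq_iff)
  ultimately obtain n where "n > 0" "(act x ^^ n) u = u" using funpow_inj_finite by metis
  then show ?thesis using that by (simp add: fold_replicate)
qed

text \<open>
  The word \<open>w\<close> itself leads back, but cancels. Before turning around, the path runs through
  a loop \<open>s ^ n\<close> for a generator \<open>s\<close> other than the one of the last letter of \<open>w\<close>, which
  exists in rank at least 2.
\<close>

lemma closing_word_exists:
  assumes "w \<in> words S" "reduced w" "w \<noteq> []"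
  obtains q where "q \<in> words S" "reduced q" "q \<noteq> [] \<Longrightarrow> hd q \<noteq> inv_letter (last w)"
    "endpoint (endpoint v\<^sub>0 w) q = v\<^sub>0"
proof -
  define u where "u = endpoint v\<^sub>0 w"
  have u: "u \<in> V" unfolding u_def using base endpoint_closed by blast
  have "\<not> S \<subseteq> {fst (last w)}"
    using card_S card_mono[of "{fst (last w)}" S] by auto
  then obtain s where s: "s \<in> S" "s \<noteq> fst (last w)" by auto
  obtain n where n: "n > 0" "endpoint u (replicate n (s, True)) = u"
    using letter_power_returns[OF u] by metis
  \<comment> \<open>The loop separates the end of \<open>w\<close> from the beginning of its inverse.\<close>
  let ?q = "replicate n (s, True) @ inv_word w"
  show ?thesis
  proof (rule that[of ?q])
    show "?q \<in> words S" using assms s by (auto simp: words_iff inv_word_def)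
    show "reduced ?q" using assms s n
      by (auto simp: reduced_append hd_inv_word inv_letter_def prod_eq_iff)
    show "hd ?q \<noteq> inv_letter (last w)"
      using n s by (cases n) (auto simp: inv_letter_def)
    show "endpoint (endpoint v\<^sub>0 w) ?q = v\<^sub>0"
      using n endpoint_inv_word[of w v\<^sub>0] by (simp add: u_def)
  qed
qed

text \<open>
  Whether a word can be appended to close a path depends only on the endpoint of the path
  and on its last letter, so finitely many closing words serve all paths.
\<close>

lemma closing_word_bounded:
  obtains c where "\<And>w. w \<in> words S \<Longrightarrow> reduced w \<Longrightarrow>
    \<exists>q\<in>words S. length q \<le> c \<and> reduced (w @ q) \<and> endpoint v\<^sub>0 (w @ q) = v\<^sub>0"
proof -
  \<comment> \<open>The relevant data of a path \<open>w\<close> are its state; \<open>good\<close> says that \<open>q\<close> closes up every path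
    with the state \<open>(u, y)\<close>.\<close>
  define good where "good = (\<lambda>(u, y) q. q \<in> words S \<and> reduced q \<and>
    (q \<noteq> [] \<longrightarrow> hd q \<noteq> inv_letter y) \<and> endpoint u q = v\<^sub>0)"
  define state where "state w = (endpoint v\<^sub>0 w, last w)" for w
  define K where "K = state ` {w \<in> words S. reduced w \<and> w \<noteq> []}"
  have "K \<subseteq> V \<times> (S \<times> UNIV)"
  proof
    fix k assume "k \<in> K"
    then obtain w where w: "w \<in> words S" "w \<noteq> []" "k = state w" unfolding K_def by blast
    have "endpoint v\<^sub>0 w \<in> V" using endpoint_closed base by blast
    moreover have "fst (last w) \<in> S" using w by (simp add: words_iff)
    ultimately show "k \<in> V \<times> (S \<times> UNIV)" by (simp add: w(3) state_def mem_Times_iff)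
  qed
  then have "finite K" by (rule finite_subset) (simp add: finite_V finite_S)
  have "\<forall>k\<in>K. \<exists>q. good k q"
  proof
    fix k assume "k \<in> K"
    then obtain w where w: "w \<in> words S" "reduced w" "w \<noteq> []" "k = state w" unfolding K_def by blast
    obtain q where "q \<in> words S" "reduced q" "q \<noteq> [] \<Longrightarrow> hd q \<noteq> inv_letter (last w)"
        "endpoint (endpoint v\<^sub>0 w) q = v\<^sub>0"
      using closing_word_exists[OF w(1-3)] by blast
    then show "\<exists>q. good k q" unfolding w(4) state_def good_def by auto
  qed
  then obtain f where f: "\<And>k. k \<in> K \<Longrightarrow> good k (f k)" by metis
  define c where "c = Max (insert 0 ((\<lambda>k. length (f k)) ` K))"
  have c: "length (f k) \<le> c" if "k \<in> K" for k
    unfolding c_def using that \<open>finite K\<close> by (intro Max_ge) auto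
  show ?thesis
  proof (rule that[of c])
    fix w :: "('a \<times> bool) list" assume w: "w \<in> words S" "reduced w"
    show "\<exists>q\<in>words S. length q \<le> c \<and> reduced (w @ q) \<and> endpoint v\<^sub>0 (w @ q) = v\<^sub>0"
    proof (cases "w = []")
      case True
      then show ?thesis by (intro bexI[of _ "[]"]) auto
    next
      case False
      then have "state w \<in> K" using w by (auto simp: K_def)
      then show ?thesis using f[of "state w"] c[of "state w"] w
        by (intro bexI[of _ "f (state w)"]) (auto simp: good_def state_def reduced_append)
    qed
  qed
qed

text \<open>
  The mirror image of \<open>closing_word_bounded\<close>, obtained by inverting words.
\<close>

lemma opening_word_bounded:
  obtains c where "\<And>u w. w \<in> words S \<Longrightarrow> reduced w \<Longrightarrow> endpoint u w = v\<^sub>0 \<Longrightarrow>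
    \<exists>p\<in>words S. length p \<le> c \<and> reduced (p @ w) \<and> endpoint v\<^sub>0 p = u"
proof -
  obtain c where c: "\<And>w. w \<in> words S \<Longrightarrow> reduced w \<Longrightarrow>
      \<exists>q\<in>words S. length q \<le> c \<and> reduced (w @ q) \<and> endpoint v\<^sub>0 (w @ q) = v\<^sub>0"
    using closing_word_bounded by blast
  show ?thesis
  proof (rule that[of c])
    fix u w assume w: "w \<in> words S" "reduced w" "endpoint u w = v\<^sub>0"
    then obtain q where q: "q \<in> words S" "length q \<le> c" "reduced (inv_word w @ q)"
        "endpoint v\<^sub>0 (inv_word w @ q) = v\<^sub>0"
      using c[of "inv_word w"] by auto
    have "endpoint v\<^sub>0 (inv_word w) = u" using w endpoint_inv_word by blast
    then have "endpoint u q = v\<^sub>0" using q by simp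
    then have "endpoint v\<^sub>0 (inv_word q) = u" using endpoint_inv_word by blast
    moreover have "reduced (inv_word q @ w)"
      using q(3) reduced_inv_word[of "inv_word w @ q"] by simp
    ultimately show "\<exists>p\<in>words S. length p \<le> c \<and> reduced (p @ w) \<and> endpoint v\<^sub>0 p = u"
      using q by (intro bexI[of _ "inv_word q"]) auto
  qed
qed

text \<open>
  The first part is the longest initial path of weight at most \<open>m\<close>. The edge that would exceed
  \<open>m\<close> is dropped, and the remainder then weighs at most \<open>n\<close>.
\<close>

lemma weight_split:
  assumes "weight M v w \<le> m + n"
  obtains w1 w2 where "w = w1 @ w2" "weight M v w1 \<le> m"
    "weight M (endpoint v (w1 @ take 1 w2)) (drop 1 w2) \<le> n"
  using assms
proof (induction w arbitrary: v m thesis)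
  case Nil
  show ?case by (rule Nil(1)[of "[]" "[]"]) auto
next
  case (Cons x w)
  let ?l = "edge_length M (edge v x)"
  show ?case
  proof (cases "?l \<le> m")
    case True
    then have "weight M (act x v) w \<le> (m - ?l) + n" using Cons.prems by simp
    then obtain w1 w2 where *: "w = w1 @ w2" "weight M (act x v) w1 \<le> m - ?l"
        "weight M (endpoint (act x v) (w1 @ take 1 w2)) (drop 1 w2) \<le> n"
      using Cons.IH by blast
    show ?thesis by (rule Cons.prems(1)[of "x # w1" w2]) (use * True in auto)
  next
    case False
    show ?thesis by (rule Cons.prems(1)[of "[]" "x # w"]) (use Cons.prems False in auto)
  qed
qed

text \<open>
  A loop of weight at most \<open>m + n\<close> is cut into an initial path, at most one letter, and a final
  path. Both paths are completed to loops by words of bounded length. The loop is recovered from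
  the two completed loops, the middle letter and the lengths of the two completions.
\<close>

lemma card_loops_almost_submultiplicative:
  obtains c D where "\<And>m n. card (loops M (m + n)) \<le> D * card (loops M (m + c)) * card (loops M (n + c))"
proof -
  obtain c1 where c1: "\<And>w. w \<in> words S \<Longrightarrow> reduced w \<Longrightarrow>
      \<exists>q\<in>words S. length q \<le> c1 \<and> reduced (w @ q) \<and> endpoint v\<^sub>0 (w @ q) = v\<^sub>0"
    using closing_word_bounded by blast
  obtain c2 where c2: "\<And>u w. w \<in> words S \<Longrightarrow> reduced w \<Longrightarrow> endpoint u w = v\<^sub>0 \<Longrightarrow>
      \<exists>p\<in>words S. length p \<le> c2 \<and> reduced (p @ w) \<and> endpoint v\<^sub>0 p = u"
    using opening_word_bounded by blast
  define c where "c = Suc (size M) * (c1 + c2)"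
  define Y where "Y = {y \<in> words S. length y \<le> 1}"
  define D where "D = Suc c * (card Y * Suc c)"
  have Y: "finite Y" unfolding Y_def by (rule finite_words_le[OF finite_S])
  have cle: "c1 + c2 \<le> c" unfolding c_def by simp
  define glue :: "('a \<times> bool) list \<times> nat \<times> ('a \<times> bool) list \<times> nat \<times> ('a \<times> bool) list \<Rightarrow> ('a \<times> bool) list"
    where "glue = (\<lambda>(a, i, y, j, b). take (length a - i) a @ y @ drop j b)"
  show ?thesis
  proof (rule that[of D c])
    fix m n
    let ?T = "loops M (m + c) \<times> {..c} \<times> Y \<times> {..c} \<times> loops M (n + c)"
    have "loops M (m + n) \<subseteq> glue ` ?T"
    proof
      fix w assume "w \<in> loops M (m + n)"
      then have w: "w \<in> words S" "reduced w" "endpoint v\<^sub>0 w = v\<^sub>0" "weight M v\<^sub>0 w \<le> m + n"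
        by (auto simp: loops_def)
      obtain w1 w2 where split: "w = w1 @ w2" "weight M v\<^sub>0 w1 \<le> m"
          "weight M (endpoint v\<^sub>0 (w1 @ take 1 w2)) (drop 1 w2) \<le> n"
        using weight_split[OF w(4)] by blast
      define y w3 where "y = take 1 w2" and "w3 = drop 1 w2"
      have w_eq: "w = w1 @ y @ w3" by (simp add: split y_def w3_def)
      define u where "u = endpoint v\<^sub>0 (w1 @ y)"
      have parts: "w1 \<in> words S" "reduced w1" "w3 \<in> words S" "reduced w3" "y \<in> Y" "endpoint u w3 = v\<^sub>0"
        using w unfolding w_eq by (auto simp: reduced_append Y_def u_def y_def)
      obtain q where q: "q \<in> words S" "length q \<le> c1" "reduced (w1 @ q)" "endpoint v\<^sub>0 (w1 @ q) = v\<^sub>0"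
        using c1 parts by blast
      obtain p where p: "p \<in> words S" "length p \<le> c2" "reduced (p @ w3)" "endpoint v\<^sub>0 p = u"
        using c2 parts by blast
      have "weight M (endpoint v\<^sub>0 w1) q \<le> c"
        using weight_le[of M "endpoint v\<^sub>0 w1" q] q(2) unfolding c_def
        by (meson le_add1 le_trans mult_le_mono2)
      moreover have "weight M v\<^sub>0 p \<le> c"
        using weight_le[of M v\<^sub>0 p] p(2) unfolding c_def
        by (meson le_add2 le_trans mult_le_mono2)
      ultimately have "w1 @ q \<in> loops M (m + c)" "p @ w3 \<in> loops M (n + c)"
        using q p parts split by (auto simp: loops_def w3_def u_def y_def)
      then have "(w1 @ q, length q, y, length p, p @ w3) \<in> ?T"
        using q p parts cle by auto
      moreover have "w = glue (w1 @ q, length q, y, length p, p @ w3)"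
        by (simp add: glue_def w_eq)
      ultimately show "w \<in> glue ` ?T" by blast
    qed
    then have "card (loops M (m + n)) \<le> card ?T"
      using finite_loops Y by (intro surj_card_le) auto
    also have "\<dots> = D * card (loops M (m + c)) * card (loops M (n + c))"
      by (simp add: card_cartesian_product D_def algebra_simps)
    finally show "card (loops M (m + n)) \<le> D * card (loops M (m + c)) * card (loops M (n + c))" .
  qed
qed

text \<open>
  Every reduced word of length \<open>n\<close> is the initial segment of a loop that is longer by a bounded
  amount.
\<close>

lemma power_le_card_loops:
  obtains c where "\<And>n. (2 * card S - 1) ^ n \<le> card (loops {#} (n + c))"
proof -
  obtain c where c: "\<And>w. w \<in> words S \<Longrightarrow> reduced w \<Longrightarrow>
      \<exists>q\<in>words S. length q \<le> c \<and> reduced (w @ q) \<and> endpoint v\<^sub>0 (w @ q) = v\<^sub>0"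
    using closing_word_bounded by blast
  show ?thesis
  proof (rule that[of c])
    fix n
    have "reduced_words S n \<subseteq> take n ` loops {#} (n + c)"
    proof
      fix w assume w: "w \<in> reduced_words S n"
      then obtain q where "q \<in> words S" "length q \<le> c" "reduced (w @ q)" "endpoint v\<^sub>0 (w @ q) = v\<^sub>0"
        using c by (auto simp: reduced_words_def)
      then show "w \<in> take n ` loops {#} (n + c)"
        using w by (intro image_eqI[of _ _ "w @ q"])
          (auto simp: loops_def reduced_words_def weight_empty)
    qed
    then have "card (reduced_words S n) \<le> card (loops {#} (n + c))"
      using finite_loops by (rule surj_card_le[rotated])
    then show "(2 * card S - 1) ^ n \<le> card (loops {#} (n + c))"
      using card_reduced_words_ge[OF finite_S, of n] card_S by linarith
  qed
qed

lemma card_loops_le: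
  assumes "k > 0" "\<And>e. e \<in> V \<times> S \<Longrightarrow> k \<le> edge_length M e"
  shows "card (loops M n) \<le> 3 * (2 * card S - 1) ^ (n div k)"
proof -
  have "length w \<le> n div k" if "w \<in> loops M n" for w
    using weight_ge[OF assms(2) base, of w] that assms(1)
    by (auto simp: loops_def less_eq_div_iff_mult_less_eq mult.commute)
  then have "loops M n \<subseteq> {w \<in> words S. reduced w \<and> length w \<le> n div k}"
    by (auto simp: loops_def)
  then have "card (loops M n) \<le> card {w \<in> words S. reduced w \<and> length w \<le> n div k}"
    by (intro card_mono finite_subset[OF _ finite_words_le[OF finite_S, of "n div k"]]) auto
  then show ?thesis using card_reduced_words_le[OF finite_S card_S, of "n div k"] by linarith
qed

end

locale large_girth_schreier_graph = schreier_graph +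
  fixes girth :: nat
  assumes girth_pos: "girth > 0"
    and no_short_loop: "v \<in> V \<Longrightarrow> w \<in> words S \<Longrightarrow> reduced w \<Longrightarrow> w \<noteq> [] \<Longrightarrow> length w \<le> girth
      \<Longrightarrow> fold act w v \<noteq> v"
begin

text \<open>
  A reduced path that meets an edge twice contains a reduced closed path: if the edge is
  traversed twice in the same direction, from the first traversal up to the second; if it is
  traversed in opposite directions, the path strictly between the two traversals, which is
  nonempty because the path does not backtrack.
\<close>

lemma distinct_trail:
  assumes "v \<in> V" "w \<in> words S" "reduced w" "length w \<le> girth"
  shows "distinct (trail v w)"
  using assms
proof (induction w arbitrary: v)
  case (Cons x w)
  have "edge v x \<notin> set (trail (act x v) w)"
  proof
    assume "edge v x \<in> set (trail (act x v) w)"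
    then obtain w1 y w2 where w: "w = w1 @ y # w2" and eq: "edge v x = edge (endpoint (act x v) w1) y"
      by (auto simp: set_trail)
    from edge_eqD[OF eq] show False
    proof
      assume "y = x \<and> v = endpoint (act x v) w1"
      moreover have "endpoint v (x # w1) \<noteq> v"
        using Cons.prems unfolding w by (intro no_short_loop) (auto simp: reduced_Cons reduced_append split: list.splits)
      ultimately show False by simp
    next
      assume *: "y = inv_letter x \<and> v = act y (endpoint (act x v) w1)"
      then have "w1 \<noteq> []" using Cons.prems(3) unfolding w by (auto simp: reduced_Cons)
      then have "endpoint (act x v) w1 \<noteq> act x v"
        using Cons.prems unfolding w by (intro no_short_loop) (auto simp: reduced_Cons reduced_append act_closed)
      moreover have "act x v = endpoint (act x v) w1" using * act_inv' by metis
      ultimately show False by simp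
    qed
  qed
  then show ?case using Cons by (auto simp: reduced_Cons act_closed)
qed simp

text \<open>
  Cut the path into pieces of length \<open>girth\<close>, each of which meets the edge at most once.
\<close>

lemma count_trail_le:
  assumes "v \<in> V" "w \<in> words S" "reduced w"
  shows "girth * count_list (trail v w) e \<le> length w + girth"
  using assms
proof (induction "length w" arbitrary: v w rule: less_induct)
  case less
  let ?a = "take girth w" and ?b = "drop girth w"
  have w: "?a @ ?b \<in> words S" "reduced (?a @ ?b)" using less.prems by simp_all
  then have ab: "?a \<in> words S" "?b \<in> words S" "reduced ?a" "reduced ?b"
    unfolding reduced_append words_simps by blast+
  have "distinct (trail v ?a)" using ab less.prems by (intro distinct_trail) auto
  then have a: "count_list (trail v ?a) e \<le> 1"
    by (cases e) (simp add: distinct_count_atmost_1 flip: count_mset)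
  show ?case
  proof (cases "length w < girth")
    case True
    then show ?thesis using a by (cases "count_list (trail v w) e") auto
  next
    case False
    then have "w \<noteq> []" using girth_pos by auto
    have "count_list (trail v w) e = count_list (trail v ?a) e + count_list (trail (endpoint v ?a) ?b) e"
      using trail_append[of v ?a ?b] by simp
    moreover have "girth * count_list (trail (endpoint v ?a) ?b) e \<le> length ?b + girth"
      using less.prems girth_pos \<open>w \<noteq> []\<close> ab by (intro less.hyps endpoint_closed) auto
    moreover have "length ?b + girth = length w" using False by simp
    ultimately show ?thesis using mult_le_mono2[OF a, of girth]
      by (simp only: distrib_left mult_1_right)
  qed
qed

text \<open>
  Subdividing one edge lengthens a loop by the number of times that it meets the edge, hence
  by a factor of at most about \<open>1 + 1 / girth\<close>.
\<close>

lemma loops_subdivide: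
  "loops M (girth * n) \<subseteq> loops (add_mset e M) ((girth + 1) * n + 1)"
proof
  fix w assume "w \<in> loops M (girth * n)"
  then have w: "w \<in> words S" "reduced w" "endpoint v\<^sub>0 w = v\<^sub>0" "weight M v\<^sub>0 w \<le> girth * n"
    by (auto simp: loops_def)
  have "girth * count_list (trail v\<^sub>0 w) e \<le> girth * n + girth"
    using count_trail_le[OF base w(1,2), of e] length_le_weight[of w M v\<^sub>0] w(4) by linarith
  then have "girth * count_list (trail v\<^sub>0 w) e \<le> girth * (n + 1)" by simp
  then have "count_list (trail v\<^sub>0 w) e \<le> n + 1" using girth_pos by (metis mult_le_cancel1)
  then show "w \<in> loops (add_mset e M) ((girth + 1) * n + 1)"
    using w by (auto simp: loops_def weight_add_mset)
qed

end

section \<open>The rates of subdivided graphs\<close>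

context schreier_graph
begin

definition rate :: "('v \<times> 'a) multiset \<Rightarrow> real" where
  "rate M = lim (\<lambda>n. root n (real (card (loops M n))))"

lemma rate_ge_1_and_tendsto:
  "1 \<le> rate M \<and> (\<lambda>n. root n (real (card (loops M n)))) \<longlonglongrightarrow> rate M"
proof -
  obtain c D where sub:
      "\<And>m n. card (loops M (m + n)) \<le> D * card (loops M (m + c)) * card (loops M (n + c))"
    using card_loops_almost_submultiplicative by blast
  have D: "D \<ge> 1"
    using sub[of 0 0] card_loops_ge_1[of M 0] by (cases D) auto
  have ge1: "1 \<le> real (card (loops M n))" for n
    using card_loops_ge_1[of M n] by linarith
  have sub': "real (card (loops M (m + n))) \<le> real D * card (loops M (m + c)) * card (loops M (n + c))" for m n
    using sub[of m n] by (simp flip: of_nat_mult)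
  obtain \<rho> where \<rho>: "1 \<le> \<rho>" "(\<lambda>n. root n (real (card (loops M n)))) \<longlonglongrightarrow> \<rho>"
    using almost_submultiplicative_root_convergent
      [of "\<lambda>n. real (card (loops M n))" "real D" c, OF ge1 _ sub'] D by auto
  have "rate M = \<rho>" unfolding rate_def using \<rho>(2) by (rule limI)
  then show ?thesis using \<rho> by simp
qed

lemmas rate_ge_1 = rate_ge_1_and_tendsto[THEN conjunct1]
  and rate_tendsto = rate_ge_1_and_tendsto[THEN conjunct2]

lemma card_loops_affine_tendsto:
  assumes "k > 0"
  shows "(\<lambda>n. root n (real (card (loops M (k * n + j))))) \<longlonglongrightarrow> rate M ^ k"
proof -
  have "1 \<le> real (card (loops M n))" for n using card_loops_ge_1[of M n] by linarith
  then show ?thesis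
    using root_subsequence_affine[OF rate_tendsto[of M] _ _ assms] rate_ge_1[of M] by simp
qed

text \<open>
  In the unsubdivided graph the closed reduced words have the growth rate of all reduced
  words.
\<close>

lemma rate_empty_ge: "2 * real (card S) - 1 \<le> rate {#}"
proof -
  obtain c where c: "\<And>n. (2 * card S - 1) ^ n \<le> card (loops {#} (n + c))"
    using power_le_card_loops by blast
  have q: "real (2 * card S - 1) = 2 * real (card S) - 1" using card_S by auto
  have "\<forall>\<^sub>F n in sequentially. real (2 * card S - 1) \<le> root n (real (card (loops {#} (1 * n + c))))"
    using eventually_gt_at_top[of 0]
  proof eventually_elim
    case (elim n)
    have "real (2 * card S - 1) ^ n \<le> real (card (loops {#} (1 * n + c)))"
      using c[of n] by (simp flip: of_nat_power)
    then have "root n (real (2 * card S - 1) ^ n) \<le> root n (real (card (loops {#} (1 * n + c))))"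
      using elim by simp
    then show ?case using elim by (simp add: real_root_power_cancel)
  qed
  with card_loops_affine_tendsto[of 1 "{#}" c]
  have "real (2 * card S - 1) \<le> rate {#} ^ 1" by (intro tendsto_lowerbound) auto
  then show ?thesis using q by simp
qed

text \<open>
  If all edges have length at least \<open>k\<close>, a loop of weight at most \<open>n\<close> is a reduced word of
  length at most \<open>n div k\<close>.
\<close>

lemma rate_le:
  assumes "k > 0" "\<And>e. e \<in> V \<times> S \<Longrightarrow> k \<le> edge_length M e"
  shows "rate M \<le> root k (2 * real (card S) - 1)"
proof -
  define q where "q = real (2 * card S - 1)"
  have q: "q = 2 * real (card S) - 1" "q \<ge> 1" using card_S by (auto simp: q_def)
  have rq: "root k q \<ge> 1" using q assms by simp
  have "\<forall>\<^sub>F n in sequentially. root n (real (card (loops M n))) \<le> root n 3 * root k q"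
    using eventually_gt_at_top[of 0]
  proof eventually_elim
    case (elim n)
    have "real (card (loops M n)) \<le> 3 * q ^ (n div k)"
      using card_loops_le[OF assms, of n] unfolding q_def by (simp flip: of_nat_power)
    also have "q ^ (n div k) = root k q ^ (k * (n div k))"
      using assms q by (simp add: power_mult)
    also have "\<dots> \<le> root k q ^ n" using rq by (intro power_increasing) auto
    finally have "root n (real (card (loops M n))) \<le> root n (3 * root k q ^ n)" using elim by simp
    then show ?case using elim rq by (simp add: real_root_mult real_root_power_cancel)
  qed
  moreover have "(\<lambda>n. root n 3 * root k q) \<longlonglongrightarrow> 1 * root k q"
    by (intro tendsto_intros LIMSEQ_root_const) auto
  ultimately show ?thesis using tendsto_le[OF _ _ rate_tendsto[of M]] q by fastforce
qed

lemma rate_upper: "rate M \<le> 2 * real (card S) - 1"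
  using rate_le[of 1 M] by (simp add: edge_length_def)

lemma rate_arbitrarily_small:
  assumes "x > 1"
  obtains M where "rate M < x"
proof -
  define q where "q = 2 * real (card S) - 1"
  have "(\<lambda>k. root k q) \<longlonglongrightarrow> 1" using card_S by (intro LIMSEQ_root_const) (auto simp: q_def)
  then have "\<forall>\<^sub>F k in sequentially. root k q < x \<and> k > 0"
    using assms by (intro eventually_conj order_tendstoD(2) eventually_gt_at_top)
  then obtain k where k: "root k q < x" "k > 0"
    by (metis (mono_tags, lifting) eventually_sequentially order_refl)
  have "rate (repeat_mset k (mset_set (V \<times> S))) \<le> root k q"
    unfolding q_def using k finite_V finite_S
    by (intro rate_le) (auto simp: edge_length_def count_mset_set)
  then show ?thesis using that le_less_trans k(1) by blast
qed

end

context large_girth_schreier_graph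
begin

text \<open>
  One more subdivision keeps at least the fraction \<open>girth / (girth + 1)\<close> of the logarithm
  of the rate, wherever the edge lies and however often the others are already
  subdivided.
\<close>

lemma rate_subdivide: "rate M ^ girth \<le> rate (add_mset e M) ^ (girth + 1)"
proof (rule tendsto_le)
  show "(\<lambda>n. root n (real (card (loops M (girth * n + 0))))) \<longlonglongrightarrow> rate M ^ girth"
    using girth_pos by (rule card_loops_affine_tendsto)
  show "(\<lambda>n. root n (real (card (loops (add_mset e M) ((girth + 1) * n + 1)))))
      \<longlonglongrightarrow> rate (add_mset e M) ^ (girth + 1)"
    by (rule card_loops_affine_tendsto) simp
  show "\<forall>\<^sub>F n in sequentially. root n (real (card (loops M (girth * n + 0))))
      \<le> root n (real (card (loops (add_mset e M) ((girth + 1) * n + 1))))"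
    using eventually_gt_at_top[of 0]
  proof eventually_elim
    case (elim n)
    show ?case using card_mono[OF finite_loops loops_subdivide, of M n e] elim by simp
  qed
qed simp

text \<open>
  A discrete intermediate value argument: along a sequence of single subdivisions the rate
  decreases from its maximum to values near 1, in steps that are too small to jump over the
  interval from \<open>x\<close> to \<open>x * root girth x\<close>.
\<close>

lemma rate_approximates:
  assumes x: "1 < x" "x \<le> 2 * real (card S) - 1"
  obtains M where "x \<le> rate M" "rate M < x * root girth x"
proof -
  have "\<exists>M. x \<le> rate M \<and> rate M ^ girth < x ^ (girth + 1)"
  proof (rule ccontr)
    assume "\<nexists>M. x \<le> rate M \<and> rate M ^ girth < x ^ (girth + 1)"
    then have jump: "x ^ (girth + 1) \<le> rate M ^ girth" if "x \<le> rate M" for M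
      using that not_le by blast
    have "x \<le> rate M" for M
    proof (induction M)
      case empty
      show ?case using x rate_empty_ge by linarith
    next
      case (add e M)
      have "x ^ (girth + 1) \<le> rate (add_mset e M) ^ (girth + 1)"
        using jump[OF add] rate_subdivide[of M e] by linarith
      then show ?case using rate_ge_1[of "add_mset e M"] by (intro power_le_imp_le_base[of x girth]) auto
    qed
    moreover obtain M where "rate M < x" using rate_arbitrarily_small x by blast
    ultimately show False using not_le by blast
  qed
  then obtain M where M: "x \<le> rate M" "rate M ^ girth < x ^ (girth + 1)" by blast
  have "x ^ (girth + 1) = (x * root girth x) ^ girth"
    using x girth_pos by (simp add: power_mult_distrib)
  then have "rate M ^ girth < (x * root girth x) ^ girth" using M(2) by simp
  moreover have "0 \<le> x * root girth x" using x girth_pos by simp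
  ultimately have "rate M < x * root girth x" by (rule power_less_imp_less_base)
  with M(1) show ?thesis by (rule that)
qed

end

section \<open>Subgroups of closed paths\<close>

lemma inv_word_replicate [simp]: "inv_word (replicate n x) = replicate n (inv_letter x)"
  by (simp add: inv_word_def)

context schreier_graph
begin

lemma edge_length_pos [simp]: "0 < edge_length M e"
  by (simp add: edge_length_def)

text \<open>
  The label of a path after subdivision: an edge with label \<open>s\<close> becomes a path of edges with
  label \<open>s\<close>. Vertices of degree 2 between equal labels do not create backtracking, so reduced
  words remain reduced.
\<close>

fun subdivide :: "('v \<times> 'a) multiset \<Rightarrow> 'v \<Rightarrow> ('a \<times> bool) list \<Rightarrow> ('a \<times> bool) list" where
  "subdivide M v [] = []"
| "subdivide M v (x # w) = replicate (edge_length M (edge v x)) x @ subdivide M (act x v) w"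

lemma subdivide_append: "subdivide M v (w @ w') = subdivide M v w @ subdivide M (endpoint v w) w'"
  by (induction w arbitrary: v) auto

lemma length_subdivide: "length (subdivide M v w) = weight M v w"
  by (induction w arbitrary: v) auto

lemma subdivide_in_words: "w \<in> words S \<Longrightarrow> subdivide M v w \<in> words S"
  by (induction w arbitrary: v) (auto simp: words_iff)

lemma subdivide_eq_Nil_iff [simp]: "subdivide M v w = [] \<longleftrightarrow> w = []"
  by (cases w) (auto simp: edge_length_def)

lemma hd_subdivide: "w \<noteq> [] \<Longrightarrow> hd (subdivide M v w) = hd w"
  by (cases w) (auto simp: edge_length_def)

lemma reduced_subdivide: "reduced w \<Longrightarrow> reduced (subdivide M v w)"
proof (induction w arbitrary: v)
  case (Cons x w)
  then show ?case
    by (cases "w = []") (auto simp: reduced_Cons reduced_append hd_subdivide)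
qed simp

lemma subdivide_inv_word: "subdivide M (endpoint v w) (inv_word w) = inv_word (subdivide M v w)"
proof (induction w arbitrary: v)
  case (Cons x w)
  show ?case using Cons[of "act x v"]
    by (simp add: subdivide_append endpoint_inv_word edge_inv)
qed simp

lemma subdivide_inj: "subdivide M v w = subdivide M v w' \<Longrightarrow> w = w'"
proof (induction w arbitrary: v w')
  case Nil
  then have "subdivide M v w' = []" by simp
  then show ?case by simp
next
  case (Cons x w)
  have "subdivide M v (x # w) \<noteq> []" by (simp only: subdivide_eq_Nil_iff list.distinct not_False_eq_True)
  then have "subdivide M v w' \<noteq> []" using Cons.prems by (simp only: not_False_eq_True)
  then obtain y u where w': "w' = y # u" by (cases w') auto
  have "hd (subdivide M v (x # w)) = hd (subdivide M v w')" using Cons.prems by simp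
  then have "x = y" by (simp only: hd_subdivide w' list.sel list.distinct not_False_eq_True)
  then show ?case using Cons w' by auto
qed

lemma endpoint_reduce: "endpoint v (reduce w) = endpoint v w"
proof (induction w arbitrary: v)
  case (Cons x w)
  show ?case
  proof (rule reduce_Cons_cases[of "reduce w" x])
    fix w' assume w': "reduce w = inv_letter x # w'" "reduce_Cons x (reduce w) = w'"
    then show ?thesis using Cons[of "act x v"] by (simp add: reduce_simps act_inv)
  qed (use Cons in \<open>simp add: reduce_simps\<close>)
qed (simp add: reduce_simps)

end

text \<open>
  Used to close up an initial path and reopen it again.
\<close>

lemma (in group) insert_inverse:
  assumes "a \<in> carrier G" "b \<in> carrier G" "d \<in> carrier G"
  shows "a \<otimes> d = (a \<otimes> b) \<otimes> (inv b \<otimes> d)"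
proof -
  have "b \<otimes> (inv b \<otimes> d) = d" using assms by (simp add: m_assoc[symmetric])
  then show ?thesis using assms by (simp add: m_assoc)
qed

locale schreier_subgroup = group G + schreier_graph S act V v\<^sub>0
  for G :: "('a, 'b) monoid_scheme" (structure) and S :: "'a set"
    and act :: "'a \<times> bool \<Rightarrow> 'v \<Rightarrow> 'v" and V and v\<^sub>0 +
  assumes free: "free_generating_set G S"
begin

lemma S_carrier: "S \<subseteq> carrier G"
  and free_words: "\<forall>w\<in>words S. reduced w \<and> w \<noteq> [] \<longrightarrow> word_val G w \<noteq> \<one>"
  using free by (auto simp: free_generating_set_def)

text \<open>
  The group element read along a path of the subdivided graph.
\<close>

definition holonomy where
  "holonomy M v w = word_val G (subdivide M v w)"

lemma holonomy_closed [simp]: "w \<in> words S \<Longrightarrow> holonomy M v w \<in> carrier G"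
  by (simp add: holonomy_def word_val_closed[OF S_carrier] subdivide_in_words)

lemma holonomy_Nil [simp]: "holonomy M v [] = \<one>"
  by (simp add: holonomy_def)

lemma holonomy_append:
  "w \<in> words S \<Longrightarrow> w' \<in> words S \<Longrightarrow>
    holonomy M v (w @ w') = holonomy M v w \<otimes> holonomy M (endpoint v w) w'"
  by (simp add: holonomy_def subdivide_append word_val_append[OF S_carrier] subdivide_in_words)

lemma holonomy_inv_word:
  "w \<in> words S \<Longrightarrow> holonomy M (endpoint v w) (inv_word w) = inv (holonomy M v w)"
  by (simp add: holonomy_def subdivide_inv_word word_val_inv_word[OF S_carrier] subdivide_in_words)

lemma holonomy_reduce: "w \<in> words S \<Longrightarrow> holonomy M v (reduce w) = holonomy M v w"
proof (induction w arbitrary: v)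
  case (Cons x w)
  have x: "[x] \<in> words S" and w: "w \<in> words S" using Cons.prems by auto
  have split: "holonomy M v (x # u) = holonomy M v [x] \<otimes> holonomy M (act x v) u" if "u \<in> words S" for u
    using holonomy_append[OF x that, of M v] by simp
  show ?case
  proof (rule reduce_Cons_cases[of "reduce w" x])
    fix w' assume w': "reduce w = inv_letter x # w'" "reduce_Cons x (reduce w) = w'"
    have "reduce w \<in> words S" using w by (rule reduce_in_words)
    then have w'_words: "w' \<in> words S" using w' by simp
    have "holonomy M v (x # w) = holonomy M v [x] \<otimes> holonomy M (act x v) (inv_word [x] @ w')"
      using split[OF w] Cons.IH[OF w, of "act x v"] w' by simp
    also have "holonomy M (act x v) (inv_word [x] @ w') = inv (holonomy M v [x]) \<otimes> holonomy M v w'"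
      using holonomy_append[of "inv_word [x]" w' M "act x v"] holonomy_inv_word[OF x, of M v] x w'_words
      by (simp add: act_inv)
    also have "holonomy M v [x] \<otimes> (inv (holonomy M v [x]) \<otimes> holonomy M v w') = holonomy M v w'"
      using x w'_words by (simp add: m_assoc[symmetric])
    finally show ?thesis using w' by (simp add: reduce_simps)
  next
    assume "reduce_Cons x (reduce w) = x # reduce w"
    then show ?thesis
      using split[OF w] split[OF reduce_in_words[OF w]] Cons.IH[OF w] by (simp add: reduce_simps)
  qed
qed (simp add: reduce_simps)

definition loop_subgroup where
  "loop_subgroup M = holonomy M v\<^sub>0 ` {w \<in> words S. endpoint v\<^sub>0 w = v\<^sub>0}"

lemma subgroup_loop_subgroup: "subgroup (loop_subgroup M) G"
proof (rule subgroupI)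
  show "loop_subgroup M \<subseteq> carrier G" by (auto simp: loop_subgroup_def)
  show "loop_subgroup M \<noteq> {}"
    unfolding loop_subgroup_def by (auto intro!: exI[of _ "[]"])
next
  fix h assume "h \<in> loop_subgroup M"
  then obtain w where w: "w \<in> words S" "endpoint v\<^sub>0 w = v\<^sub>0" "h = holonomy M v\<^sub>0 w"
    by (auto simp: loop_subgroup_def)
  then show "inv h \<in> loop_subgroup M"
    unfolding loop_subgroup_def
    using holonomy_inv_word[of w M v\<^sub>0] endpoint_inv_word[of w v\<^sub>0]
    by (intro image_eqI[of _ _ "inv_word w"]) auto
next
  fix h k assume "h \<in> loop_subgroup M" "k \<in> loop_subgroup M"
  then obtain w u where w: "w \<in> words S" "endpoint v\<^sub>0 w = v\<^sub>0" "h = holonomy M v\<^sub>0 w"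
      and u: "u \<in> words S" "endpoint v\<^sub>0 u = v\<^sub>0" "k = holonomy M v\<^sub>0 u"
    by (auto simp: loop_subgroup_def)
  then show "h \<otimes> k \<in> loop_subgroup M"
    unfolding loop_subgroup_def
    by (intro image_eqI[of _ _ "w @ u"]) (auto simp: holonomy_append)
qed

lemma loop_subgroup_reduced:
  "loop_subgroup M = holonomy M v\<^sub>0 ` {w \<in> words S. reduced w \<and> endpoint v\<^sub>0 w = v\<^sub>0}"
proof -
  have "holonomy M v\<^sub>0 w \<in> holonomy M v\<^sub>0 ` {w \<in> words S. reduced w \<and> endpoint v\<^sub>0 w = v\<^sub>0}"
    if "w \<in> words S" "endpoint v\<^sub>0 w = v\<^sub>0" for w
    using that by (intro image_eqI[of _ _ "reduce w"])
      (auto simp: holonomy_reduce reduce_in_words reduced_reduce endpoint_reduce)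
  then show ?thesis by (auto simp: loop_subgroup_def)
qed

text \<open>
  Close up every initial segment of a loop by a short path. Consecutive closed-up segments
  differ by a short loop, so the values of the short loops generate.
\<close>

lemma fg_loop_subgroup: "fg_subgroup (loop_subgroup M) G"
proof -
  obtain c where c: "\<And>w. w \<in> words S \<Longrightarrow> reduced w \<Longrightarrow>
      \<exists>q\<in>words S. length q \<le> c \<and> reduced (w @ q) \<and> endpoint v\<^sub>0 (w @ q) = v\<^sub>0"
    using closing_word_bounded by blast
  define T where "T = holonomy M v\<^sub>0 ` {w \<in> words S. endpoint v\<^sub>0 w = v\<^sub>0 \<and> length w \<le> 2 * c + 1}"
  have "finite T"
    unfolding T_def by (intro finite_imageI finite_subset[OF _ finite_words_le[OF finite_S, of "2 * c + 1"]]) auto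
  have T: "T \<subseteq> loop_subgroup M" by (auto simp: T_def loop_subgroup_def)
  have gen: "holonomy M v\<^sub>0 (w @ q) \<in> generate G T"
    if "w \<in> words S" "reduced w" "q \<in> words S" "length q \<le> c" "endpoint v\<^sub>0 (w @ q) = v\<^sub>0" for w q
    using that
  proof (induction w arbitrary: q rule: rev_induct)
    case Nil
    then have "holonomy M v\<^sub>0 q \<in> T" by (auto simp: T_def)
    then show ?case by (simp add: generate.incl)
  next
    case (snoc x w)
    have w: "w \<in> words S" "reduced w" using snoc.prems by (auto simp: reduced_append)
    then obtain p where p: "p \<in> words S" "length p \<le> c" "endpoint v\<^sub>0 (w @ p) = v\<^sub>0" using c by blast
    let ?u = "inv_word p @ [x] @ q"
    have at_w: "endpoint v\<^sub>0 (inv_word p) = endpoint v\<^sub>0 w"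
      using p(3) endpoint_inv_word[of p "endpoint v\<^sub>0 w"] by simp
    have u: "?u \<in> words S" "endpoint v\<^sub>0 ?u = v\<^sub>0" "length ?u \<le> 2 * c + 1"
      using snoc.prems p at_w by auto
    have words: "[x] @ q \<in> words S" using snoc.prems by simp
    have "holonomy M v\<^sub>0 (w @ [x] @ q) = holonomy M v\<^sub>0 w \<otimes> holonomy M (endpoint v\<^sub>0 w) ([x] @ q)"
      using holonomy_append[OF w(1) words] .
    also have "\<dots> = (holonomy M v\<^sub>0 w \<otimes> holonomy M (endpoint v\<^sub>0 w) p) \<otimes>
        (inv (holonomy M (endpoint v\<^sub>0 w) p) \<otimes> holonomy M (endpoint v\<^sub>0 w) ([x] @ q))"
      using w p words by (intro insert_inverse) (simp_all del: append.simps)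
    also have "holonomy M v\<^sub>0 w \<otimes> holonomy M (endpoint v\<^sub>0 w) p = holonomy M v\<^sub>0 (w @ p)"
      using holonomy_append[OF w(1) p(1)] by simp
    also have "inv (holonomy M (endpoint v\<^sub>0 w) p) \<otimes> holonomy M (endpoint v\<^sub>0 w) ([x] @ q) = holonomy M v\<^sub>0 ?u"
      using holonomy_append[of "inv_word p" "[x] @ q" M v\<^sub>0] holonomy_inv_word[OF p(1), of M "endpoint v\<^sub>0 w"]
        p words at_w by simp
    finally have eq: "holonomy M v\<^sub>0 ((w @ [x]) @ q) = holonomy M v\<^sub>0 (w @ p) \<otimes> holonomy M v\<^sub>0 ?u" by simp
    have "holonomy M v\<^sub>0 ?u \<in> T" unfolding T_def using u by blast
    then show ?case unfolding eq by (rule generate.eng[OF snoc.IH[OF w p] generate.incl])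
  qed
  have "generate G T = loop_subgroup M"
  proof
    show "generate G T \<subseteq> loop_subgroup M"
      by (rule generate_subgroup_incl[OF T subgroup_loop_subgroup])
    show "loop_subgroup M \<subseteq> generate G T"
      unfolding loop_subgroup_reduced using gen[of _ "[]"] by auto
  qed
  then show ?thesis
    unfolding fg_subgroup_def using subgroup_loop_subgroup \<open>finite T\<close> T by blast
qed

lemma holonomy_inj:
  assumes "w \<in> words S" "w' \<in> words S" "reduced w" "reduced w'" "holonomy M v w = holonomy M v w'"
  shows "w = w'"
proof -
  have "subdivide M v w = subdivide M v w'"
    using assms by (intro reduced_word_unique[OF S_carrier free_words])
      (auto simp: holonomy_def subdivide_in_words reduced_subdivide)
  then show ?thesis by (rule subdivide_inj)
qed

lemma word_length_holonomy:
  "w \<in> words S \<Longrightarrow> reduced w \<Longrightarrow> word_length G S (holonomy M v w) = weight M v w"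
  unfolding holonomy_def
  by (simp add: word_length_reduced[OF S_carrier free_words] subdivide_in_words reduced_subdivide length_subdivide)

text \<open>
  By freeness the elements of the subgroup correspond to the reduced loops, and word length
  corresponds to weight.
\<close>

lemma growth_function_loop_subgroup: "growth_function G S (loop_subgroup M) n = card (loops M n)"
proof -
  have "{h \<in> loop_subgroup M. word_length G S h \<le> n} = holonomy M v\<^sub>0 ` loops M n"
    by (auto simp: loop_subgroup_reduced loops_def word_length_holonomy)
  moreover have "inj_on (holonomy M v\<^sub>0) (loops M n)"
    by (rule inj_onI) (rule holonomy_inj, auto simp: loops_def)
  ultimately show ?thesis by (simp add: growth_function_def card_image)
qed

lemma growth_rate_loop_subgroup: "growth_rate G S (loop_subgroup M) = rate M"
  by (simp add: growth_rate_def rate_def growth_function_loop_subgroup)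

end

section \<open>Finite covers of large girth\<close>

text \<open>
  For letters \<open>c\<close> in \<open>S \<times> UNIV\<close>, regarded as involutions, these words are the ball of
  radius \<open>n\<close> in the free product of copies of the group of order 2.
\<close>

definition alternating_words :: "'a set \<Rightarrow> nat \<Rightarrow> ('a \<times> bool) list set" where
  "alternating_words S n = {w \<in> words S. distinct_adj w \<and> length w \<le> n}"

text \<open>
  Left multiplication by the involution \<open>c\<close>, made the identity where it would leave \<open>X\<close>. A
  partial involution extends to a permutation in this way, which is why involutions are used.
\<close>

definition toggle :: "'c list set \<Rightarrow> 'c \<Rightarrow> 'c list \<Rightarrow> 'c list" where
  "toggle X c w = (if w \<in> X \<and> c # w \<in> X then c # w
     else if w \<in> X \<and> w \<noteq> [] \<and> hd w = c then tl w else w)"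

lemma alternating_words_Cons:
  "c # w \<in> alternating_words S n \<Longrightarrow> w \<in> alternating_words S n"
  "c # c # w \<notin> alternating_words S n"
  by (auto simp: alternating_words_def distinct_adj_Cons)

lemma toggle_toggle: "toggle (alternating_words S n) c (toggle (alternating_words S n) c w) = w"
  using alternating_words_Cons[of c _ S n] by (cases w) (auto simp: toggle_def)

lemma toggle_permutes: "toggle (alternating_words S n) c permutes alternating_words S n"
  unfolding permutes_def
proof (intro conjI allI impI)
  fix w assume "w \<notin> alternating_words S n"
  then show "toggle (alternating_words S n) c w = w" by (simp add: toggle_def)
next
  fix w show "\<exists>!u. toggle (alternating_words S n) c u = w"
    using toggle_toggle by metis
qed

text \<open>
  The image of a word under the embedding of the free group into the free product of
  involutions that sends a letter \<open>x\<close> to the product of the involutions \<open>x\<close> and \<open>inv_letter x\<close>.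
\<close>

definition doubled :: "('a \<times> bool) list \<Rightarrow> ('a \<times> bool) list" where
  "doubled w = concat (map (\<lambda>x. [x, inv_letter x]) w)"

lemma doubled_in_alternating_words:
  "w \<in> words S \<Longrightarrow> reduced w \<Longrightarrow> 2 * length w \<le> n \<Longrightarrow> doubled w \<in> alternating_words S n"
proof (induction w)
  case (Cons x w)
  have "doubled w \<in> alternating_words S n" using Cons by (simp add: reduced_Cons)
  moreover have "length (doubled w) = 2 * length w" by (induction w) (auto simp: doubled_def)
  moreover have "w = [] \<or> (\<exists>u. doubled w = hd w # u)" by (cases w) (auto simp: doubled_def)
  ultimately show ?case using Cons.prems
    by (auto simp: alternating_words_def reduced_Cons doubled_def)
qed (simp add: alternating_words_def doubled_def)

text \<open>
  The vertices are the permutations of a ball of radius \<open>2 * g\<close>, and a letter acts by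
  composition with two toggles. Because a permutation group acts freely on itself by composition,
  a word has a fixed point only if its permutation is the identity. A nonempty
  reduced word of length at most \<open>g\<close> moves the empty word to its doubled word, so no such word
  has a fixed point.
\<close>

lemma large_girth_schreier_graph_exists:
  fixes S :: "'a set"
  assumes "finite S" "card S \<ge> 2" "g > 0"
  obtains act :: "'a \<times> bool \<Rightarrow> (('a \<times> bool) list \<Rightarrow> ('a \<times> bool) list) \<Rightarrow> (('a \<times> bool) list \<Rightarrow> ('a \<times> bool) list)"
    and V v\<^sub>0 where "large_girth_schreier_graph S act V v\<^sub>0 g"
proof -
  define X where "X = alternating_words S (2 * g)"
  define \<tau> where "\<tau> = toggle X"
  define act :: "'a \<times> bool \<Rightarrow> (('a \<times> bool) list \<Rightarrow> ('a \<times> bool) list) \<Rightarrow> (('a \<times> bool) list \<Rightarrow> ('a \<times> bool) list)"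
    where "act x v = v \<circ> \<tau> x \<circ> \<tau> (inv_letter x)" for x v
  have invol: "\<tau> c (\<tau> c w) = w" for c w unfolding \<tau>_def X_def by (rule toggle_toggle)
  have perm: "\<tau> c permutes X" for c unfolding \<tau>_def X_def by (rule toggle_permutes)
  have "finite X"
    unfolding X_def by (rule finite_subset[OF _ finite_words_le[OF assms(1), of "2 * g"]])
      (auto simp: alternating_words_def)
  have path: "fold act w v [] = v (doubled w)"
    if "w \<in> words S" "reduced w" "length w \<le> g" for w v
    using that
  proof (induction w arbitrary: v)
    case (Cons x w)
    have "doubled (x # w) \<in> X" using Cons.prems
      unfolding X_def by (intro doubled_in_alternating_words) auto
    then have "x # inv_letter x # doubled w \<in> X" by (simp add: doubled_def)
    moreover from this have "inv_letter x # doubled w \<in> X" "doubled w \<in> X"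
      unfolding X_def using alternating_words_Cons(1) by blast+
    ultimately have "\<tau> x (\<tau> (inv_letter x) (doubled w)) = doubled (x # w)"
      by (simp add: \<tau>_def toggle_def doubled_def)
    then show ?case using Cons by (simp add: reduced_Cons act_def)
  qed (simp add: doubled_def)
  have "large_girth_schreier_graph S act {f. f permutes X} id g"
  proof
    show "finite S" "card S \<ge> 2" "g > 0" by (fact assms)+
    show "finite {f. f permutes X}" using \<open>finite X\<close> by (rule finite_permutations)
    show "id \<in> {f. f permutes X}" by (simp add: permutes_id)
    show "act x v \<in> {f. f permutes X}" if "v \<in> {f. f permutes X}" for x v
      using that unfolding act_def by (simp add: permutes_compose perm)
    show "act (inv_letter x) (act x v) = v" for x v
      by (simp add: act_def fun_eq_iff invol)
    show "fold act w v \<noteq> v" if v: "v \<in> {f. f permutes X}" and w: "w \<in> words S" "reduced w" "w \<noteq> []" "length w \<le> g" for v w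
    proof
      assume "fold act w v = v"
      then have "v (doubled w) = v []" using path[OF w(1,2,4), of v] by simp
      then have "doubled w = []" using v permutes_inj by (metis injD mem_Collect_eq)
      then show False using w(3) by (cases w) (auto simp: doubled_def)
    qed
  qed
  then show ?thesis by (rule that)
qed

section \<open>Density of the growth rates\<close>

theorem theorem1:
  fixes G :: "('a, 'b) monoid_scheme" and S :: "'a set" and r :: nat
  assumes "group G"
    and "free_generating_set G S"
    and "card S = r"
    and "r \<ge> 2"
  shows "top_of_set {1..2 * real r - 1} closure_of {growth_rate G S H |H. fg_subgroup H G}
           = {1..2 * real r - 1}"
proof -
  define q where "q = 2 * real r - 1"
  have q: "q \<ge> 3" using assms by (simp add: q_def)
  have S: "finite S" "card S \<ge> 2" using assms by (auto intro: card_ge_0_finite)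
  have approx: "\<exists>H. fg_subgroup H G \<and> growth_rate G S H \<in> {1..q} \<and> dist (growth_rate G S H) x < e"
    if x: "x \<in> {1..q}" and "e > 0" for x e
  proof -
    \<comment> \<open>Rates above 1 can be approximated from above, so \<open>x = 1\<close> is replaced by a slightly
      larger number, without leaving the interval.\<close>
    define y where "y = max x (min q (1 + e / 2))"
    have y: "1 < y" "y \<le> q" "x \<le> y" "y \<le> x + e / 2"
      using x \<open>e > 0\<close> q by (auto simp: y_def)
    have "(\<lambda>g. y * root g y) \<longlonglongrightarrow> y * 1"
      using y by (intro tendsto_intros LIMSEQ_root_const) auto
    then have "\<forall>\<^sub>F g in sequentially. y * root g y < y + e / 2 \<and> g > 0"
      using \<open>e > 0\<close> by (intro eventually_conj order_tendstoD(2) eventually_gt_at_top) auto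
    then obtain g where g: "y * root g y < y + e / 2" "g > 0"
      by (metis (mono_tags, lifting) eventually_sequentially order_refl)
    obtain act :: "'a \<times> bool \<Rightarrow> (('a \<times> bool) list \<Rightarrow> ('a \<times> bool) list) \<Rightarrow> (('a \<times> bool) list \<Rightarrow> ('a \<times> bool) list)"
      and V v\<^sub>0 where graph: "large_girth_schreier_graph S act V v\<^sub>0 g"
      using large_girth_schreier_graph_exists[OF S g(2)] by blast
    interpret large_girth_schreier_graph S act V v\<^sub>0 g by (fact graph)
    interpret group G by (fact assms(1))
    interpret schreier_subgroup G S act V v\<^sub>0 by unfold_locales (fact assms(2))
    obtain M where M: "y \<le> rate M" "rate M < y * root g y"
      using rate_approximates[of y] y assms(3) by (auto simp: q_def)
    have "fg_subgroup (loop_subgroup M) G" by (rule fg_loop_subgroup)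
    moreover have "growth_rate G S (loop_subgroup M) \<in> {1..q}"
      using rate_ge_1[of M] rate_upper[of M] assms(3) by (simp add: growth_rate_loop_subgroup q_def)
    moreover have "dist (growth_rate G S (loop_subgroup M)) x < e"
      using M y g by (simp add: growth_rate_loop_subgroup dist_real_def)
    ultimately show ?thesis by blast
  qed
  have "x \<in> (top_of_set {1..q}) closure_of {growth_rate G S H |H. fg_subgroup H G}"
    if x: "x \<in> {1..q}" for x
    unfolding in_closure_of
  proof (intro conjI allI impI)
    show "x \<in> topspace (top_of_set {1..q})" using x by simp
    fix T assume T: "x \<in> T \<and> openin (top_of_set {1..q}) T"
    then obtain e where e: "e > 0" "\<And>z. z \<in> {1..q} \<Longrightarrow> dist z x < e \<Longrightarrow> z \<in> T"
      unfolding openin_euclidean_subtopology_iff by metis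
    then show "\<exists>z. z \<in> {growth_rate G S H |H. fg_subgroup H G} \<and> z \<in> T"
      using approx[OF x e(1)] by blast
  qed
  moreover have "(top_of_set {1..q}) closure_of {growth_rate G S H |H. fg_subgroup H G} \<subseteq> {1..q}"
    using closure_of_subset_topspace[of "top_of_set {1..q}"] by simp
  ultimately show ?thesis unfolding q_def by blast
qed

end
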